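(* Let $O$ be a locally finite totally ordered set and $A\in\mathscr E_O$. Then $A=\bigvee_{I\in A}\{I\}$, and this is the only irredundant representation of $A$ as a join of a set of $\vee$-irreducible elements of $\mathscr E_O$.
   Context: $O$ is a locally finite totally ordered set; $\mathscr I_O$ is the set of finite intervals of $O$ (convex subsets, including $\emptyset$). $\mathscr E_O$ is the set of antichains with respect to inclusion of elements of $\mathscr I_O$, ordered by $A\le B$ iff for every $I\in A$ there is $J\in B$ with $J\subseteq I$; it is a complete lattice with bottom $0=\emptyset$. An element $x\neq 0$ is $\vee$-irreducible if $x=a\vee b$ implies $x=a$ or $x=b$. A representation $A=\bigvee X$ with $X$ a set of $\vee$-irreducible elements is irredundant if $\bigvee Y\ne A$ for every proper subset $Y\subsetneq X$. *)

theory Defs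
  imports "HOL-Algebra.Complete_Lattice"
begin

definition locally_finite :: "('a, 'm) gorder_scheme \<Rightarrow> bool" where
  "locally_finite P \<longleftrightarrow> (\<forall>a\<in>carrier P. \<forall>b\<in>carrier P. finite \<lbrace>a..b\<rbrace>\<^bsub>P\<^esub>)"

text \<open>Intervals are convex subsets of the carrier; the empty set is one of them.\<close>

definition order_convex :: "('a, 'm) gorder_scheme \<Rightarrow> 'a set \<Rightarrow> bool" where
  "order_convex P I \<longleftrightarrow> I \<subseteq> carrier P \<and> (\<forall>a\<in>I. \<forall>b\<in>I. \<lbrace>a..b\<rbrace>\<^bsub>P\<^esub> \<subseteq> I)"

definition finite_intervals :: "('a, 'm) gorder_scheme \<Rightarrow> 'a set set" where
  "finite_intervals P = {I. order_convex P I \<and> finite I}"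

definition interval_antichains :: "('a, 'm) gorder_scheme \<Rightarrow> 'a set set set" where
  "interval_antichains P =
     {A. A \<subseteq> finite_intervals P \<and> (\<forall>I\<in>A. \<forall>J\<in>A. I \<subseteq> J \<longrightarrow> I = J)}"

definition antichain_order :: "('a, 'm) gorder_scheme \<Rightarrow> 'a set set gorder" where
  "antichain_order P =
     \<lparr>carrier = interval_antichains P, eq = (=),
      le = (\<lambda>A B. \<forall>I\<in>A. \<exists>J\<in>B. J \<subseteq> I)\<rparr>"

definition join_irreducible :: "('a, 'm) gorder_scheme \<Rightarrow> 'a \<Rightarrow> bool" where
  "join_irreducible L x \<longleftrightarrow>
     x \<in> carrier L \<and> x \<noteq> \<bottom>\<^bsub>L\<^esub> \<and>
     (\<forall>a\<in>carrier L. \<forall>b\<in>carrier L. x = a \<squnion>\<^bsub>L\<^esub> b \<longrightarrow> x = a \<or> x = b)"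

definition irredundant_representation ::
    "('a, 'm) gorder_scheme \<Rightarrow> 'a \<Rightarrow> 'a set \<Rightarrow> bool" where
  "irredundant_representation L x X \<longleftrightarrow>
     X \<subseteq> {y. join_irreducible L y} \<and> x = \<Squnion>\<^bsub>L\<^esub>X \<and> (\<forall>Y. Y \<subset> X \<longrightarrow> \<Squnion>\<^bsub>L\<^esub>Y \<noteq> x)"

text \<open>
  In HOL-Algebra the join and the bottom element are chosen by Hilbert's operator, so they
  are meaningful only when the corresponding least elements exist. The facts below show that
  they do for the order on antichains. The suprema and infima are the sets of minimal elements
  of the up-closed families involved.
\<close>

definition minimal_sets :: "'a set set \<Rightarrow> 'a set set" where
  "minimal_sets U = {I \<in> U. \<forall>J\<in>U. J \<subseteq> I \<longrightarrow> J = I}"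

lemma minimal_sets_below:
  assumes "finite I" "I \<in> U"
  shows "\<exists>J\<in>minimal_sets U. J \<subseteq> I"
  using assms
proof (induction I rule: finite_psubset_induct)
  case (psubset I)
  show ?case
  proof (cases "I \<in> minimal_sets U")
    case False
    then obtain J where J: "J \<in> U" "J \<subset> I"
      using psubset.prems by (auto simp: minimal_sets_def)
    then show ?thesis
      using psubset.IH[of J] by blast
  qed blast
qed

lemma minimal_sets_interval_antichain:
  "U \<subseteq> finite_intervals P \<Longrightarrow> minimal_sets U \<in> interval_antichains P"
  by (auto simp: minimal_sets_def interval_antichains_def)

lemma partial_order_antichain_order: "partial_order (antichain_order P)"
proof
  fix A B
  assume A: "A \<in> carrier (antichain_order P)" and B: "B \<in> carrier (antichain_order P)"
    and AB: "A \<sqsubseteq>\<^bsub>antichain_order P\<^esub> B" and BA: "B \<sqsubseteq>\<^bsub>antichain_order P\<^esub> A"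
  have *: "C \<subseteq> D"
    if C: "C \<in> interval_antichains P"
      and CD: "\<forall>I\<in>C. \<exists>J\<in>D. J \<subseteq> I" and DC: "\<forall>I\<in>D. \<exists>J\<in>C. J \<subseteq> I" for C D
  proof
    fix I assume I: "I \<in> C"
    then obtain J where J: "J \<in> D" "J \<subseteq> I" using CD by blast
    then obtain K where K: "K \<in> C" "K \<subseteq> J" using DC by blast
    then have "K = I" using C I J unfolding interval_antichains_def by blast
    then have "J = I" using J(2) K(2) by simp
    then show "I \<in> D" using J(1) by simp
  qed
  show "A .=\<^bsub>antichain_order P\<^esub> B"
    using *[of A B] *[of B A] A B AB BA by (simp add: antichain_order_def)
next
  fix A B C
  assume "A \<sqsubseteq>\<^bsub>antichain_order P\<^esub> B" "B \<sqsubseteq>\<^bsub>antichain_order P\<^esub> C"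
  then show "A \<sqsubseteq>\<^bsub>antichain_order P\<^esub> C"
    by (simp add: antichain_order_def) (meson order_trans)
qed (auto simp: antichain_order_def)

lemma complete_lattice_antichain_order: "complete_lattice (antichain_order P)"
proof -
  interpret partial_order "antichain_order P" by (rule partial_order_antichain_order)
  have fin: "finite I" if "I \<in> A" "A \<in> interval_antichains P" for I A
    using that by (auto simp: interval_antichains_def finite_intervals_def)
  show ?thesis
  proof
    fix X assume X: "X \<subseteq> carrier (antichain_order P)"
    then have XE: "X \<subseteq> interval_antichains P" by (simp add: antichain_order_def)
    have U: "\<Union>X \<subseteq> finite_intervals P"
      using XE by (auto simp: interval_antichains_def)
    have up: "\<exists>J\<in>minimal_sets (\<Union>X). J \<subseteq> I" if "A \<in> X" "I \<in> A" for I A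
      using minimal_sets_below[of I "\<Union>X"] fin[of I A] that XE by blast
    have sub: "minimal_sets (\<Union>X) \<subseteq> \<Union>X" by (auto simp: minimal_sets_def)
    have "least (antichain_order P) (minimal_sets (\<Union>X)) (Upper (antichain_order P) X)"
    proof (rule least_UpperI)
      show "A \<sqsubseteq>\<^bsub>antichain_order P\<^esub> minimal_sets (\<Union>X)" if "A \<in> X" for A
        using up[OF that] by (simp add: antichain_order_def)
      show "minimal_sets (\<Union>X) \<sqsubseteq>\<^bsub>antichain_order P\<^esub> B"
        if "B \<in> Upper (antichain_order P) X" for B
      proof -
        have "\<forall>A\<in>X. \<forall>I\<in>A. \<exists>J\<in>B. J \<subseteq> I"
          using that XE by (auto simp: Upper_def antichain_order_def)
        then show ?thesis using sub by (simp add: antichain_order_def) blast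
      qed
      show "minimal_sets (\<Union>X) \<in> carrier (antichain_order P)"
        using minimal_sets_interval_antichain[OF U] by (simp add: antichain_order_def)
    qed (fact X)
    then show "\<exists>s. least (antichain_order P) s (Upper (antichain_order P) X)" ..
    define V where "V = {I \<in> finite_intervals P. \<forall>A\<in>X. \<exists>J\<in>A. J \<subseteq> I}"
    have V: "V \<subseteq> finite_intervals P" by (auto simp: V_def)
    have below: "\<exists>J\<in>minimal_sets V. J \<subseteq> I"
      if "B \<in> interval_antichains P" "\<forall>A\<in>X. \<forall>I\<in>B. \<exists>J\<in>A. J \<subseteq> I" "I \<in> B" for I B
    proof (rule minimal_sets_below)
      show "finite I" using fin that by blast
      show "I \<in> V" using that by (auto simp: V_def interval_antichains_def)
    qed
    have "greatest (antichain_order P) (minimal_sets V) (Lower (antichain_order P) X)"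
    proof (rule greatest_LowerI)
      show "minimal_sets V \<sqsubseteq>\<^bsub>antichain_order P\<^esub> A" if "A \<in> X" for A
        using that by (simp add: antichain_order_def minimal_sets_def V_def)
      show "B \<sqsubseteq>\<^bsub>antichain_order P\<^esub> minimal_sets V"
        if "B \<in> Lower (antichain_order P) X" for B
      proof -
        have "B \<in> interval_antichains P" "\<forall>A\<in>X. \<forall>I\<in>B. \<exists>J\<in>A. J \<subseteq> I"
          using that XE by (auto simp: Lower_def antichain_order_def)
        from below[OF this] show ?thesis by (simp add: antichain_order_def)
      qed
      show "minimal_sets V \<in> carrier (antichain_order P)"
        using minimal_sets_interval_antichain[OF V] by (simp add: antichain_order_def)
    qed (fact X)
    then show "\<exists>s. greatest (antichain_order P) s (Lower (antichain_order P) X)" ..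
  qed
qed

lemma bottom_antichain_order: "\<bottom>\<^bsub>antichain_order P\<^esub> = {}"
proof -
  interpret complete_lattice "antichain_order P" by (rule complete_lattice_antichain_order)
  have "{} \<in> carrier (antichain_order P)"
    by (simp add: antichain_order_def interval_antichains_def)
  then have "\<bottom>\<^bsub>antichain_order P\<^esub> \<sqsubseteq>\<^bsub>antichain_order P\<^esub> {}"
    by (rule bottom_lower)
  then show ?thesis by (auto simp: antichain_order_def)
qed

end

theory Submission
  imports Defs
begin

text \<open>
  A join in the lattice of antichains is the set of inclusion-minimal elements of the union.
  Consequently the \<open>\<or>\<close>-irreducible elements are exactly the singletons \<open>{I}\<close>, so a representation
  of \<open>A\<close> is a family \<open>B\<close> of finite intervals whose set of minimal elements is \<open>A\<close>. Such a family
  contains \<open>A\<close>, and \<open>A\<close> itself is already one, so irredundancy forces \<open>B = A\<close>.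
\<close>

lemma carrier_antichain_order: "carrier (antichain_order P) = interval_antichains P"
  by (simp add: antichain_order_def)

text \<open>Antisymmetry identifies the two sides. Intervals are finite, so each member of the union
  contains a minimal one, which makes the right side an upper bound of \<open>X\<close>. Conversely,
  a minimal member lies in some element of \<open>X\<close>, and the join is above that
  element.\<close>

lemma sup_antichain_order:
  assumes X: "X \<subseteq> interval_antichains P"
  shows "\<Squnion>\<^bsub>antichain_order P\<^esub>X = minimal_sets (\<Union>X)"
proof -
  interpret complete_lattice "antichain_order P" by (rule complete_lattice_antichain_order)
  have XC: "X \<subseteq> carrier (antichain_order P)"
    using X by (simp add: carrier_antichain_order)
  have U: "\<Union>X \<subseteq> finite_intervals P"
    using X by (auto simp: interval_antichains_def)
  have MC: "minimal_sets (\<Union>X) \<in> carrier (antichain_order P)"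
    using minimal_sets_interval_antichain[OF U] by (simp add: carrier_antichain_order)
  have "\<Squnion>\<^bsub>antichain_order P\<^esub>X \<sqsubseteq>\<^bsub>antichain_order P\<^esub> minimal_sets (\<Union>X)"
  proof (rule sup_least[OF XC MC])
    fix B assume "B \<in> X"
    have "\<exists>J\<in>minimal_sets (\<Union>X). J \<subseteq> I" if "I \<in> B" for I
      using minimal_sets_below[of I "\<Union>X"] that \<open>B \<in> X\<close> U by (auto simp: finite_intervals_def)
    then show "B \<sqsubseteq>\<^bsub>antichain_order P\<^esub> minimal_sets (\<Union>X)"
      by (simp add: antichain_order_def)
  qed
  moreover have "minimal_sets (\<Union>X) \<sqsubseteq>\<^bsub>antichain_order P\<^esub> \<Squnion>\<^bsub>antichain_order P\<^esub>X"
  proof -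
    have "\<exists>J\<in>\<Squnion>\<^bsub>antichain_order P\<^esub>X. J \<subseteq> I" if "B \<in> X" "I \<in> B" for I B
      using sup_upper[OF XC \<open>B \<in> X\<close>] \<open>I \<in> B\<close> by (simp add: antichain_order_def)
    then show ?thesis
      by (auto simp: antichain_order_def minimal_sets_def)
  qed
  ultimately show ?thesis
    using le_antisym[OF _ _ sup_closed[OF XC] MC] by (simp add: antichain_order_def)
qed

lemma join_antichain_order:
  assumes "a \<in> interval_antichains P" "b \<in> interval_antichains P"
  shows "a \<squnion>\<^bsub>antichain_order P\<^esub> b = minimal_sets (a \<union> b)"
  using sup_antichain_order[of "{a, b}" P] assms by (simp add: join_def)

lemma minimal_sets_antichain:
  "A \<in> interval_antichains P \<Longrightarrow> minimal_sets A = A"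
  by (auto simp: minimal_sets_def interval_antichains_def)

lemma interval_antichains_subset:
  "A \<in> interval_antichains P \<Longrightarrow> B \<subseteq> A \<Longrightarrow> B \<in> interval_antichains P"
  by (simp add: interval_antichains_def) (meson subset_iff)

text \<open>If \<open>{I}\<close> is a join of \<open>a\<close> and \<open>b\<close>, then
  \<open>I\<close> belongs to one of them, and every member of that one contains \<open>I\<close>;
  being an antichain, it is \<open>{I}\<close>.\<close>

lemma join_irreducible_singleton:
  assumes I: "I \<in> finite_intervals P"
  shows "join_irreducible (antichain_order P) {I}"
proof -
  have eq: "{I} = a"
    if a: "a \<in> interval_antichains P" and b: "b \<subseteq> finite_intervals P"
      and ab: "{I} = minimal_sets (a \<union> b)" and Ia: "I \<in> a" for a b
  proof -
    have "K = I" if K: "K \<in> a" for K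
    proof -
      have "finite K" using a K by (auto simp: interval_antichains_def finite_intervals_def)
      \<comment> \<open>By finiteness \<open>K\<close> contains a minimal member of the union, and
        \<open>I\<close> is the only one.\<close>
      then have "I \<subseteq> K" using minimal_sets_below[of K "a \<union> b"] K ab by auto
      then show ?thesis using a K Ia by (auto simp: interval_antichains_def)
    qed
    then show ?thesis using Ia by blast
  qed
  have "{I} = a \<or> {I} = b"
    if a: "a \<in> interval_antichains P" and b: "b \<in> interval_antichains P"
      and ab: "{I} = minimal_sets (a \<union> b)" for a b
  proof -
    have "a \<subseteq> finite_intervals P" "b \<subseteq> finite_intervals P"
      using a b by (auto simp: interval_antichains_def)
    moreover have "I \<in> a \<or> I \<in> b"
      using ab by (auto simp: minimal_sets_def)
    ultimately show ?thesis
      using eq[OF a _ ab] eq[OF b, of a] ab by (auto simp: Un_commute)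
  qed
  moreover have "{I} \<in> interval_antichains P"
    using I by (simp add: interval_antichains_def)
  ultimately show ?thesis
    by (simp add: join_irreducible_def bottom_antichain_order carrier_antichain_order
        join_antichain_order)
qed

text \<open>For the forward direction, split off a member \<open>I\<close> of \<open>y\<close>.
  Since \<open>y\<close> is an antichain, it is the join of \<open>{I}\<close> and
  \<open>y - {I}\<close>, and the second part differs from \<open>y\<close>.\<close>

lemma join_irreducible_antichain_order_iff:
  "join_irreducible (antichain_order P) y \<longleftrightarrow> (\<exists>I\<in>finite_intervals P. y = {I})"
proof
  assume y: "join_irreducible (antichain_order P) y"
  then have yE: "y \<in> interval_antichains P" and "y \<noteq> {}"
    by (simp_all add: join_irreducible_def bottom_antichain_order carrier_antichain_order)
  then obtain I where I: "I \<in> y" by blast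
  have parts: "{I} \<in> interval_antichains P" "y - {I} \<in> interval_antichains P"
    using interval_antichains_subset[OF yE] I by auto
  moreover have "{I} \<union> (y - {I}) = y" using I by blast
  ultimately have "y = {I} \<squnion>\<^bsub>antichain_order P\<^esub> (y - {I})"
    using join_antichain_order minimal_sets_antichain[OF yE] by metis
  moreover have "{I} \<in> carrier (antichain_order P)" "y - {I} \<in> carrier (antichain_order P)"
    using parts by (simp_all add: carrier_antichain_order)
  ultimately have "y = {I} \<or> y = y - {I}"
    using y unfolding join_irreducible_def by blast
  then show "\<exists>I\<in>finite_intervals P. y = {I}"
    using I yE by (auto simp: interval_antichains_def)
qed (auto simp: join_irreducible_singleton)

text \<open>Here \<open>B\<close> need not be an antichain: this covers every family of irreducible
  elements, hence every candidate representation.\<close>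

lemma sup_singletons:
  assumes "B \<subseteq> finite_intervals P"
  shows "\<Squnion>\<^bsub>antichain_order P\<^esub>((\<lambda>I. {I}) ` B) = minimal_sets B"
proof -
  have "(\<lambda>I. {I}) ` B \<subseteq> interval_antichains P"
    using assms by (auto simp: interval_antichains_def)
  from sup_antichain_order[OF this] show ?thesis by simp
qed

theorem theorem11:
  fixes P :: "('a, 'm) gorder_scheme" and A :: "'a set set"
  assumes "total_order P"
    and "locally_finite P"
    and "A \<in> carrier (antichain_order P)"
  shows "A = \<Squnion>\<^bsub>antichain_order P\<^esub>((\<lambda>I. {I}) ` A) \<and>
    (\<forall>X. irredundant_representation (antichain_order P) A X \<longleftrightarrow> X = (\<lambda>I. {I}) ` A)"
proof -
  have AE: "A \<in> interval_antichains P"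
    using assms(3) by (simp add: carrier_antichain_order)
  then have Afin: "A \<subseteq> finite_intervals P"
    by (simp add: interval_antichains_def)
  have supA: "\<Squnion>\<^bsub>antichain_order P\<^esub>((\<lambda>I. {I}) ` A) = A"
    using sup_singletons[OF Afin] minimal_sets_antichain[OF AE] by simp
  have "irredundant_representation (antichain_order P) A ((\<lambda>I. {I}) ` A)"
    unfolding irredundant_representation_def
  proof (intro conjI allI impI)
    show "(\<lambda>I. {I}) ` A \<subseteq> {y. join_irreducible (antichain_order P) y}"
      using Afin join_irreducible_singleton by blast
    fix Y assume Y: "Y \<subset> (\<lambda>I. {I}) ` A"
    then obtain C where C: "C \<subseteq> A" "Y = (\<lambda>I. {I}) ` C"
      by (meson psubset_imp_subset subset_image_iff)
    \<comment> \<open>A subfamily of an antichain is an antichain, so the join of \<open>Y\<close>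
      is \<open>C\<close> itself, and dropping any interval changes the join.\<close>
    have "minimal_sets C = C"
      using minimal_sets_antichain interval_antichains_subset[OF AE C(1)] by blast
    then have "\<Squnion>\<^bsub>antichain_order P\<^esub>Y = C"
      using sup_singletons[of C P] C Afin by auto
    then show "\<Squnion>\<^bsub>antichain_order P\<^esub>Y \<noteq> A"
      using Y C by blast
  qed (simp add: supA)
  moreover have "X = (\<lambda>I. {I}) ` A"
    if X: "irredundant_representation (antichain_order P) A X" for X
  proof -
    have "X \<subseteq> (\<lambda>I. {I}) ` finite_intervals P"
      using X by (auto simp: irredundant_representation_def join_irreducible_antichain_order_iff)
    then obtain B where B: "B \<subseteq> finite_intervals P" "X = (\<lambda>I. {I}) ` B"
      by (meson subset_image_iff)
    have "A = minimal_sets B"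
      using X B sup_singletons[OF B(1)] by (simp add: irredundant_representation_def)
    then have "A \<subseteq> B"
      by (auto simp: minimal_sets_def)
    then have "(\<lambda>I. {I}) ` A \<subseteq> X"
      using B by blast
    \<comment> \<open>If the inclusion were proper, the singletons from \<open>A\<close> would form
      a proper subset of \<open>X\<close> with join \<open>A\<close>, against irredundancy.\<close>
    moreover have "\<not> (\<lambda>I. {I}) ` A \<subset> X"
      using X supA unfolding irredundant_representation_def by blast
    ultimately show ?thesis by blast
  qed
  ultimately have "\<forall>X. irredundant_representation (antichain_order P) A X \<longleftrightarrow> X = (\<lambda>I. {I}) ` A"
    by metis
  with supA[symmetric] show ?thesis
    by (rule conjI)
qed

end
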